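(* Let $K$ and $L$ be simplicial complexes (geometric or abstract) with disjoint vertex sets whose join $K \ast L$ exists. Let $p, q \geq 0$, let $w$ be a $p$-cycle in $\mathcal{C}(K) \otimes \mathbb{Z}/2$ and let $z$ be a $q$-cycle in $\mathcal{C}(L) \otimes \mathbb{Z}/2$ such that $w \ast z$ represents a non-trivial (nonzero) class in the reduced homology $\tilde{H}_{p+q+1}(K \ast L; \mathbb{Z}/2)$. Then $w$ represents a non-trivial class in $\tilde{H}_{p}(K; \mathbb{Z}/2)$ and $z$ represents a non-trivial class in $\tilde{H}_{q}(L; \mathbb{Z}/2)$.
   Context: For simplices $\sigma \in K$ and $\tau \in L$, $\sigma \ast \tau$ denotes the simplex whose vertex set is the union of the vertices of $\sigma$ and the vertices of $\tau$; so $\dim(\sigma \ast \tau) = \dim \sigma + \dim \tau + 1$. The join $K \ast L$ is the simplicial complex consisting of all $\sigma \ast \tau$ with $\sigma \in K$, $\tau \in L$, and all faces of such; in particular, the simplices of $K$ and of $L$ belong to $K \ast L$. In the geometric case, the existence of the join includes the assumption that for all $\sigma \in K$ and $\tau \in L$ the vertices of $\sigma$ together with those of $\tau$ are geometrically (affinely) independent. In the abstract case, the join always exists when the vertex sets are disjoint. For a simplicial complex $X$, $\mathcal{C}(X)$ denotes the augmented integer simplicial chain complex of $X$ (with $C_{-1}(X) = \mathbb{Z}$), and $\tilde{H}_{\ast}(X; \mathbb{Z}/2)$ denotes reduced homology, i.e. the homology of $\mathcal{C}(X) \otimes \mathbb{Z}/2$. Cycles are cycles of this augmented complex. If $c = \sigma_{1}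 + \cdots + \sigma_{m}$ is a $p$-chain in $\mathcal{C}(K) \otimes \mathbb{Z}/2$ and $d = \tau_{1} + \cdots + \tau_{n}$ is a $q$-chain in $\mathcal{C}(L) \otimes \mathbb{Z}/2$ ($p, q \geq 0$; the $\sigma_i$ are $p$-simplices of $K$, the $\tau_j$ are $q$-simplices of $L$), then $c \ast d$ is the $(p+q+1)$-chain $\sum_{i=1}^{m} \sum_{j=1}^{n} \sigma_{i} \ast \tau_{j}$ of $K \ast L$ with $\mathbb{Z}/2$ coefficients. If $c$ and $d$ are cycles, then so is $c \ast d$. *)

theory Defs
  imports "HOL-Analysis.Analysis" "HOL-Algebra.Coset" "HOL-Library.Poly_Mapping" "HOL-Library.Z2"
begin

text \<open>
  Abstract simplices are finite vertex sets and geometric simplices are convex hulls of finite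
  affinely independent sets. The chain complexes of both kinds of simplicial complex are
  obtained from the following data. In both cases the empty set is the simplex of dimension -1.
\<close>

record 'a simplex_kind =
  sdim :: "'a set \<Rightarrow> int"
  sface :: "'a set \<Rightarrow> 'a set \<Rightarrow> bool"
  sjoin :: "'a set \<Rightarrow> 'a set \<Rightarrow> 'a set"

definition abstract_kind :: "'v simplex_kind" where
  "abstract_kind = \<lparr>sdim = (\<lambda>\<sigma>. int (card \<sigma>) - 1), sface = (\<subseteq>), sjoin = (\<union>)\<rparr>"

text \<open>
  If the vertices of \<open>S\<close> and those of \<open>T\<close> are together affinely independent, then
  \<open>convex hull (S \<union> T)\<close> is the simplex spanned by all these vertices.
\<close>

definition geometric_kind :: "'a::euclidean_space simplex_kind" where
  "geometric_kind =
    \<lparr>sdim = aff_dim, sface = (face_of), sjoin = (\<lambda>S T. convex hull (S \<union> T))\<rparr>"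

text \<open>
  As in the library notion \<^const>\<open>simplicial_complex\<close>, a nonempty complex contains
  the empty simplex, because it is a face of every simplex. Unlike there, complexes may be infinite.
\<close>

definition abstract_complex :: "'v set set \<Rightarrow> bool" where
  "abstract_complex K \<longleftrightarrow> (\<forall>\<sigma>\<in>K. finite \<sigma>) \<and> (\<forall>\<rho> \<sigma>. \<sigma> \<in> K \<and> \<rho> \<subseteq> \<sigma> \<longrightarrow> \<rho> \<in> K)"

definition geometric_complex :: "'a::euclidean_space set set \<Rightarrow> bool" where
  "geometric_complex K \<longleftrightarrow>
    (\<forall>S\<in>K. \<exists>n. n simplex S) \<and>
    (\<forall>F S. S \<in> K \<and> F face_of S \<longrightarrow> F \<in> K) \<and>
    (\<forall>S S'. S \<in> K \<and> S' \<in> K \<longrightarrow> (S \<inter> S') face_of S)"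

lemma simplicial_complex_iff_geometric_complex:
  "simplicial_complex K \<longleftrightarrow> finite K \<and> geometric_complex K"
  by (auto simp: simplicial_complex_def geometric_complex_def)

definition vertices :: "'a set set \<Rightarrow> 'a set" where
  "vertices K = {v. {v} \<in> K}"

text \<open>
  The simplices of \<open>K\<close> and of \<open>L\<close> are included explicitly so that they belong to the
  join also when the other complex is void; otherwise they are already faces of joins.
\<close>

definition join_complex :: "'a simplex_kind \<Rightarrow> 'a set set \<Rightarrow> 'a set set \<Rightarrow> 'a set set" where
  "join_complex k K L = {\<rho>. \<exists>\<sigma>\<in>K. \<exists>\<tau>\<in>L. sface k \<rho> (sjoin k \<sigma> \<tau>)} \<union> K \<union> L"

definition geometric_join_exists :: "'a::euclidean_space set set \<Rightarrow> 'a set set \<Rightarrow> bool" where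
  "geometric_join_exists K L \<longleftrightarrow>
    (\<forall>S\<in>K. \<forall>T\<in>L.
       \<not> affine_dependent ({v. v extreme_point_of S} \<union> {v. v extreme_point_of T})) \<and>
    geometric_complex (join_complex geometric_kind K L)"

text \<open>
  The p-chains of the augmented integer chain complex tensored with Z/2 are the finitely supported
  functions from p-simplices to \<^typ>\<open>bit\<close>; the orientation signs of the boundary disappear
  modulo 2. The empty simplex is inserted so that the group in degree -1 is Z/2 for the void
  complex as well; the boundary of a 0-simplex is the empty simplex, which gives the augmentation.
\<close>

type_synonym 'a chain = "'a set \<Rightarrow>\<^sub>0 bit"

definition chains :: "'a simplex_kind \<Rightarrow> 'a set set \<Rightarrow> int \<Rightarrow> 'a chain set" where
  "chains k X p = {c. Poly_Mapping.keys c \<subseteq> {\<sigma> \<in> insert {} X. sdim k \<sigma> = p}}"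

definition simplex_boundary :: "'a simplex_kind \<Rightarrow> 'a set \<Rightarrow> 'a chain" where
  "simplex_boundary k \<sigma> =
    (\<Sum>\<rho>\<in>{\<rho>. sface k \<rho> \<sigma> \<and> sdim k \<rho> = sdim k \<sigma> - 1}. Poly_Mapping.single \<rho> 1)"

text \<open>
  Over Z/2 every coefficient on the support is 1, so a chain is the sum of the simplices in
  its support.
\<close>

definition chain_boundary :: "'a simplex_kind \<Rightarrow> 'a chain \<Rightarrow> 'a chain" where
  "chain_boundary k c = (\<Sum>\<sigma>\<in>Poly_Mapping.keys c. simplex_boundary k \<sigma>)"

definition chain_join :: "'a simplex_kind \<Rightarrow> 'a chain \<Rightarrow> 'a chain \<Rightarrow> 'a chain" where
  "chain_join k c d =
    (\<Sum>\<sigma>\<in>Poly_Mapping.keys c. \<Sum>\<tau>\<in>Poly_Mapping.keys d. Poly_Mapping.single (sjoin k \<sigma> \<tau>) 1)"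

definition cycles :: "'a simplex_kind \<Rightarrow> 'a set set \<Rightarrow> int \<Rightarrow> 'a chain set" where
  "cycles k X p = {c \<in> chains k X p. chain_boundary k c = 0}"

definition boundaries :: "'a simplex_kind \<Rightarrow> 'a set set \<Rightarrow> int \<Rightarrow> 'a chain set" where
  "boundaries k X p = chain_boundary k ` chains k X (p + 1)"

definition cycle_group :: "'a simplex_kind \<Rightarrow> 'a set set \<Rightarrow> int \<Rightarrow> 'a chain monoid" where
  "cycle_group k X p = \<lparr>carrier = cycles k X p, mult = (+), one = 0\<rparr>"

definition reduced_homology_group ::
    "'a simplex_kind \<Rightarrow> 'a set set \<Rightarrow> int \<Rightarrow> 'a chain set monoid" where
  "reduced_homology_group k X p = cycle_group k X p Mod boundaries k X p"

definition homology_class ::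
    "'a simplex_kind \<Rightarrow> 'a set set \<Rightarrow> int \<Rightarrow> 'a chain \<Rightarrow> 'a chain set" where
  "homology_class k X p c = boundaries k X p #>\<^bsub>cycle_group k X p\<^esub> c"

definition represents_nontrivial_class ::
    "'a simplex_kind \<Rightarrow> 'a set set \<Rightarrow> int \<Rightarrow> 'a chain \<Rightarrow> bool" where
  "represents_nontrivial_class k X p c \<longleftrightarrow>
    c \<in> cycles k X p \<and> homology_class k X p c \<noteq> \<one>\<^bsub>reduced_homology_group k X p\<^esub>"

end

theory Submission
  imports Defs
begin

text \<open>
  The join of chains satisfies a Leibniz rule modulo 2:
  \<open>\<partial>(c * d) = \<partial>c * d + c * \<partial>d\<close>. On a pair of simplices this holds because a facet of
  \<open>\<sigma> * \<tau>\<close> omits one vertex, which is a vertex of exactly one of \<open>\<sigma>\<close> and \<open>\<tau>\<close>; the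
  augmentation makes the rule valid for 0-simplices too, whose only facet is the empty simplex.
  The general case follows by bilinearity.

  If \<open>w = \<partial>c\<close> for a chain \<open>c\<close> of \<open>K\<close>, then \<open>\<partial>(c * z) = w * z + c * \<partial>z = w * z\<close>, so that
  \<open>w * z\<close> bounds in \<open>K * L\<close>. The same argument applies to \<open>z\<close>. Hence \<open>w * z\<close> can
  represent a nonzero class only if neither factor is a boundary.

  The two kinds of complexes are treated together. The rule is local: it concerns only the faces
  of a single simplex \<open>\<sigma> * \<tau>\<close>, and there both kinds are images of the Boolean lattice of vertex
  sets, under the identity in the abstract case and under the convex hull in the geometric case
  (lemmas \<open>abstract_joinable\<close> and \<open>geometric_joinable\<close>).
\<close>

section \<open>Linear extension over the field with two elements\<close>

definition linear_extension :: "('a \<Rightarrow> 'b::comm_monoid_add) \<Rightarrow> ('a \<Rightarrow>\<^sub>0 bit) \<Rightarrow> 'b" where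
  "linear_extension f c = (\<Sum>x\<in>Poly_Mapping.keys c. f x)"

lemma chain_add_self: "c + c = (0 :: 'a \<Rightarrow>\<^sub>0 bit)"
  by (rule poly_mapping_eqI) (simp add: lookup_add)

lemma linear_extension_superset:
  assumes "finite U" and "Poly_Mapping.keys c \<subseteq> U"
  shows "linear_extension f c = (\<Sum>x\<in>U. if Poly_Mapping.lookup c x = 1 then f x else 0)"
proof -
  have "(\<Sum>x\<in>U. if Poly_Mapping.lookup c x = 1 then f x else 0)
      = (\<Sum>x\<in>Poly_Mapping.keys c. if Poly_Mapping.lookup c x = 1 then f x else 0)"
    using assms by (intro sum.mono_neutral_right) (auto simp: in_keys_iff)
  also have "\<dots> = linear_extension f c"
    unfolding linear_extension_def
    by (rule sum.cong) (auto simp: in_keys_iff)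
  finally show ?thesis ..
qed

text \<open>
  A simplex in both supports drops out of \<open>c + d\<close>; its value occurs twice on the other side and
  cancels there because the codomain has exponent two.
\<close>

lemma linear_extension_add:
  fixes f :: "'a \<Rightarrow> 'b \<Rightarrow>\<^sub>0 bit"
  shows "linear_extension f (c + d) = linear_extension f c + linear_extension f d"
proof -
  let ?U = "Poly_Mapping.keys c \<union> Poly_Mapping.keys d"
  let ?t = "\<lambda>c x. if Poly_Mapping.lookup c x = 1 then f x else 0"
  have "?t (c + d) x = ?t c x + ?t d x" for x
    by (cases "Poly_Mapping.lookup c x"; cases "Poly_Mapping.lookup d x")
      (auto simp: lookup_add chain_add_self)
  then have "(\<Sum>x\<in>?U. ?t (c + d) x) = (\<Sum>x\<in>?U. ?t c x) + (\<Sum>x\<in>?U. ?t d x)"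
    by (simp add: sum.distrib)
  then show ?thesis
    using Poly_Mapping.keys_add[of c d] by (simp add: linear_extension_superset[of ?U])
qed

lemma linear_extension_0 [simp]: "linear_extension f 0 = 0"
  by (simp add: linear_extension_def)

lemma linear_extension_single [simp]:
  "linear_extension f (Poly_Mapping.single x 1) = f x"
  by (simp add: linear_extension_def)

lemma linear_extension_sum:
  fixes f :: "'a \<Rightarrow> 'b \<Rightarrow>\<^sub>0 bit"
  shows "linear_extension f (\<Sum>i\<in>I. g i) = (\<Sum>i\<in>I. linear_extension f (g i))"
  by (induction I rule: infinite_finite_induct) (simp_all add: linear_extension_add)

lemma chain_boundary_eq_linear_extension:
  "chain_boundary k = linear_extension (simplex_boundary k)"
  by (simp add: fun_eq_iff chain_boundary_def linear_extension_def)

lemma chain_join_eq_linear_extension: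
  "chain_join k c d =
    linear_extension (\<lambda>\<sigma>. linear_extension (\<lambda>\<tau>. Poly_Mapping.single (sjoin k \<sigma> \<tau>) 1) d) c"
  by (simp add: chain_join_def linear_extension_def)

section \<open>Homology classes\<close>

lemma chains_zero: "0 \<in> chains k X p"
  by (simp add: chains_def)

lemma chains_add: "c \<in> chains k X p \<Longrightarrow> d \<in> chains k X p \<Longrightarrow> c + d \<in> chains k X p"
  using Poly_Mapping.keys_add[of c d] unfolding chains_def by blast

lemma chains_sum: "(\<And>i. i \<in> I \<Longrightarrow> g i \<in> chains k X p) \<Longrightarrow> (\<Sum>i\<in>I. g i) \<in> chains k X p"
  by (induction I rule: infinite_finite_induct) (auto simp: chains_zero chains_add)

lemma boundaries_zero: "0 \<in> boundaries k X p"
proof -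
  have "chain_boundary k 0 \<in> boundaries k X p"
    unfolding boundaries_def using chains_zero by blast
  then show ?thesis by (simp add: chain_boundary_eq_linear_extension)
qed

lemma boundaries_add:
  assumes "b \<in> boundaries k X p" and "b' \<in> boundaries k X p"
  shows "b + b' \<in> boundaries k X p"
proof -
  obtain c c' where c: "c \<in> chains k X (p + 1)" "b = chain_boundary k c"
    and c': "c' \<in> chains k X (p + 1)" "b' = chain_boundary k c'"
    using assms unfolding boundaries_def by blast
  have "b + b' = chain_boundary k (c + c')"
    using c c' by (simp add: chain_boundary_eq_linear_extension linear_extension_add)
  then show ?thesis
    using chains_add[OF c(1) c'(1)] unfolding boundaries_def by blast
qed

text \<open>
  The identity of the quotient is the subgroup of boundaries itself, and the coset of \<open>c\<close> equals
  it just when \<open>c\<close> is a boundary, since adding \<open>c\<close> twice has no effect.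
\<close>

lemma represents_nontrivial_class_iff:
  "represents_nontrivial_class k X p c \<longleftrightarrow> c \<in> cycles k X p \<and> c \<notin> boundaries k X p"
proof -
  let ?B = "boundaries k X p"
  have coset: "homology_class k X p c = (\<lambda>b. b + c) ` ?B"
    by (auto simp: homology_class_def r_coset_def cycle_group_def)
  have one: "\<one>\<^bsub>reduced_homology_group k X p\<^esub> = ?B"
    by (simp add: reduced_homology_group_def FactGroup_def)
  have cancel: "(b + c) + c = b" for b
    by (simp add: add.assoc chain_add_self)
  have "(\<lambda>b. b + c) ` ?B = ?B \<longleftrightarrow> c \<in> ?B"
  proof
    assume "(\<lambda>b. b + c) ` ?B = ?B"
    moreover have "0 + c \<in> (\<lambda>b. b + c) ` ?B" using boundaries_zero by blast
    ultimately show "c \<in> ?B" by simp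
  next
    assume c: "c \<in> ?B"
    show "(\<lambda>b. b + c) ` ?B = ?B"
    proof
      show "(\<lambda>b. b + c) ` ?B \<subseteq> ?B" using c boundaries_add by blast
      show "?B \<subseteq> (\<lambda>b. b + c) ` ?B"
        using c boundaries_add cancel by (metis image_eqI subsetI)
    qed
  qed
  then show ?thesis by (simp add: represents_nontrivial_class_def coset one)
qed

section \<open>Simplices described by their vertices\<close>

text \<open>
  Via \<open>h\<close>, the faces of the simplex \<open>h V\<close> form a copy of the lattice of subsets of \<open>V\<close>, with
  the dimension and the join of that lattice.
\<close>

definition vertex_labelling :: "'a simplex_kind \<Rightarrow> ('a set \<Rightarrow> 'a set) \<Rightarrow> 'a set \<Rightarrow> bool" where
  "vertex_labelling k h V \<longleftrightarrow>
    finite V \<and> inj_on h (Pow V) \<and>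
    (\<forall>A\<subseteq>V. sdim k (h A) = int (card A) - 1 \<and> (\<forall>\<rho>. sface k \<rho> (h A) \<longleftrightarrow> (\<exists>B\<subseteq>A. \<rho> = h B))) \<and>
    (\<forall>A\<subseteq>V. \<forall>B\<subseteq>V. sjoin k (h A) (h B) = h (A \<union> B))"

definition joinable :: "'a simplex_kind \<Rightarrow> 'a set \<Rightarrow> 'a set \<Rightarrow> bool" where
  "joinable k \<sigma> \<tau> \<longleftrightarrow>
    (\<exists>h A B. \<sigma> = h A \<and> \<tau> = h B \<and> A \<inter> B = {} \<and> vertex_labelling k h (A \<union> B))"

lemma vertex_labellingD:
  assumes "vertex_labelling k h V"
  shows "finite V"
    and "inj_on h (Pow V)"
    and "A \<subseteq> V \<Longrightarrow> sdim k (h A) = int (card A) - 1"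
    and "A \<subseteq> V \<Longrightarrow> sface k \<rho> (h A) \<longleftrightarrow> (\<exists>B\<subseteq>A. \<rho> = h B)"
    and "A \<subseteq> V \<Longrightarrow> B \<subseteq> V \<Longrightarrow> sjoin k (h A) (h B) = h (A \<union> B)"
  using assms unfolding vertex_labelling_def by simp_all

lemma simplex_boundary_vertex_labelling:
  assumes h: "vertex_labelling k h V" and A: "A \<subseteq> V"
  shows "simplex_boundary k (h A) = (\<Sum>a\<in>A. Poly_Mapping.single (h (A - {a})) 1)"
proof -
  have fin: "finite A"
    using A vertex_labellingD(1)[OF h] by (rule finite_subset)
  have dim: "sdim k (h B) = int (card B) - 1" if "B \<subseteq> A" for B
    using vertex_labellingD(3)[OF h] that A by (meson subset_trans)
  have face: "sface k \<rho> (h A) \<longleftrightarrow> (\<exists>B\<subseteq>A. \<rho> = h B)" for \<rho>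
    using A by (rule vertex_labellingD(4)[OF h])
  have inj: "inj_on (\<lambda>a. h (A - {a})) A"
  proof (rule inj_onI)
    fix a b assume ab: "a \<in> A" "b \<in> A" "h (A - {a}) = h (A - {b})"
    have "A - {a} = A - {b}"
      using vertex_labellingD(2)[OF h] ab(3) by (rule inj_onD) (use A in auto)
    then show "a = b" using ab by blast
  qed
  have "{\<rho>. sface k \<rho> (h A) \<and> sdim k \<rho> = sdim k (h A) - 1} = (\<lambda>a. h (A - {a})) ` A"
  proof (intro equalityI subsetI)
    fix \<rho> assume "\<rho> \<in> {\<rho>. sface k \<rho> (h A) \<and> sdim k \<rho> = sdim k (h A) - 1}"
    then obtain B where B: "B \<subseteq> A" "\<rho> = h B" "sdim k \<rho> = sdim k (h A) - 1"
      using face by blast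
    have "card A = Suc (card B)" using dim[OF B(1)] dim[of A] B by simp
    then have "card (A - B) = 1"
      using fin B(1) by (simp add: card_Diff_subset finite_subset)
    then obtain a where "A - B = {a}" by (rule card_1_singletonE)
    then have "a \<in> A" "B = A - {a}" using B(1) by blast+
    then show "\<rho> \<in> (\<lambda>a. h (A - {a})) ` A" using B(2) by blast
  next
    fix \<rho> assume "\<rho> \<in> (\<lambda>a. h (A - {a})) ` A"
    then obtain a where a: "a \<in> A" "\<rho> = h (A - {a})" by blast
    have "int (card (A - {a})) = int (card A) - 1"
      using card_Suc_Diff1[OF fin a(1)] by simp
    then show "\<rho> \<in> {\<rho>. sface k \<rho> (h A) \<and> sdim k \<rho> = sdim k (h A) - 1}"
      using a face dim[of A] dim[of "A - {a}"] by auto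
  qed
  then show ?thesis
    unfolding simplex_boundary_def by (simp add: sum.reindex[OF inj])
qed

text \<open>
  Removing a vertex of \<open>A \<union> B\<close> removes it from exactly one of the disjoint sets \<open>A\<close> and \<open>B\<close>.
\<close>

lemma simplex_boundary_join:
  assumes "joinable k \<sigma> \<tau>"
  shows "simplex_boundary k (sjoin k \<sigma> \<tau>) =
      linear_extension (\<lambda>\<rho>. Poly_Mapping.single (sjoin k \<rho> \<tau>) 1) (simplex_boundary k \<sigma>)
    + linear_extension (\<lambda>\<rho>. Poly_Mapping.single (sjoin k \<sigma> \<rho>) 1) (simplex_boundary k \<tau>)"
proof -
  obtain h A B where \<sigma>: "\<sigma> = h A" and \<tau>: "\<tau> = h B" and disj: "A \<inter> B = {}"
    and h: "vertex_labelling k h (A \<union> B)"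
    using assms unfolding joinable_def by blast
  have fin: "finite A" "finite B" using vertex_labellingD(1)[OF h] by auto
  have join: "sjoin k (h C) (h D) = h (C \<union> D)" if "C \<subseteq> A \<union> B" "D \<subseteq> A \<union> B" for C D
    using that by (rule vertex_labellingD(5)[OF h])
  let ?s = "\<lambda>C. Poly_Mapping.single (h C) (1 :: bit)"
  have "simplex_boundary k (sjoin k \<sigma> \<tau>) = (\<Sum>x\<in>A \<union> B. ?s (A \<union> B - {x}))"
    using simplex_boundary_vertex_labelling[OF h order_refl] by (simp add: \<sigma> \<tau> join)
  also have "\<dots> = (\<Sum>a\<in>A. ?s (A \<union> B - {a})) + (\<Sum>b\<in>B. ?s (A \<union> B - {b}))"
    using fin disj by (rule sum.union_disjoint)
  also have "(\<Sum>a\<in>A. ?s (A \<union> B - {a})) = (\<Sum>a\<in>A. ?s ((A - {a}) \<union> B))"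
  proof (rule sum.cong[OF refl])
    fix a assume "a \<in> A"
    then have "A \<union> B - {a} = (A - {a}) \<union> B" using disj by blast
    then show "?s (A \<union> B - {a}) = ?s ((A - {a}) \<union> B)" by simp
  qed
  also have "(\<Sum>a\<in>A. ?s ((A - {a}) \<union> B)) =
      linear_extension (\<lambda>\<rho>. Poly_Mapping.single (sjoin k \<rho> \<tau>) 1) (simplex_boundary k \<sigma>)"
    unfolding \<sigma> \<tau> simplex_boundary_vertex_labelling[OF h Un_upper1] linear_extension_sum
      linear_extension_single
    by (rule sum.cong[OF refl]) (subst join; auto)
  also have "(\<Sum>b\<in>B. ?s (A \<union> B - {b})) = (\<Sum>b\<in>B. ?s (A \<union> (B - {b})))"
  proof (rule sum.cong[OF refl])
    fix b assume "b \<in> B"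
    then have "A \<union> B - {b} = A \<union> (B - {b})" using disj by blast
    then show "?s (A \<union> B - {b}) = ?s (A \<union> (B - {b}))" by simp
  qed
  also have "(\<Sum>b\<in>B. ?s (A \<union> (B - {b}))) =
      linear_extension (\<lambda>\<rho>. Poly_Mapping.single (sjoin k \<sigma> \<rho>) 1) (simplex_boundary k \<tau>)"
    unfolding \<sigma> \<tau> simplex_boundary_vertex_labelling[OF h Un_upper2] linear_extension_sum
      linear_extension_single
    by (rule sum.cong[OF refl]) (subst join; auto)
  finally show ?thesis .
qed

lemma sdim_join:
  assumes "joinable k \<sigma> \<tau>"
  shows "sdim k (sjoin k \<sigma> \<tau>) = sdim k \<sigma> + sdim k \<tau> + 1"
proof -
  obtain h A B where \<sigma>: "\<sigma> = h A" and \<tau>: "\<tau> = h B" and disj: "A \<inter> B = {}"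
    and h: "vertex_labelling k h (A \<union> B)"
    using assms unfolding joinable_def by blast
  note vertex_labellingD(3)[OF h]
  moreover have "sjoin k \<sigma> \<tau> = h (A \<union> B)" and "finite A" "finite B"
    using vertex_labellingD(1,5)[OF h] by (auto simp: \<sigma> \<tau>)
  ultimately show ?thesis using disj by (simp add: \<sigma> \<tau> card_Un_disjoint)
qed

lemma join_in_join_complex:
  assumes "joinable k \<sigma> \<tau>" and "\<sigma> \<in> K" and "\<tau> \<in> L"
  shows "sjoin k \<sigma> \<tau> \<in> join_complex k K L"
proof -
  obtain h A B where "\<sigma> = h A" "\<tau> = h B" and h: "vertex_labelling k h (A \<union> B)"
    using assms(1) unfolding joinable_def by blast
  then have "sjoin k \<sigma> \<tau> = h (A \<union> B)"
    using vertex_labellingD(5)[OF h] by simp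
  then have "sface k (sjoin k \<sigma> \<tau>) (sjoin k \<sigma> \<tau>)"
    using vertex_labellingD(4)[OF h order_refl] by auto
  then show ?thesis using assms(2,3) unfolding join_complex_def by blast
qed

section \<open>The Leibniz rule and its consequence for homology\<close>

lemma chain_boundary_join:
  assumes "\<And>\<sigma> \<tau>. \<sigma> \<in> Poly_Mapping.keys c \<Longrightarrow> \<tau> \<in> Poly_Mapping.keys d \<Longrightarrow> joinable k \<sigma> \<tau>"
  shows "chain_boundary k (chain_join k c d) =
    chain_join k (chain_boundary k c) d + chain_join k c (chain_boundary k d)"
proof -
  let ?C = "Poly_Mapping.keys c" and ?D = "Poly_Mapping.keys d"
  let ?l = "\<lambda>\<sigma> \<tau>. linear_extension (\<lambda>\<rho>. Poly_Mapping.single (sjoin k \<rho> \<tau>) 1) (simplex_boundary k \<sigma>)"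
  let ?r = "\<lambda>\<sigma> \<tau>. linear_extension (\<lambda>\<rho>. Poly_Mapping.single (sjoin k \<sigma> \<rho>) 1) (simplex_boundary k \<tau>)"
  have "chain_boundary k (chain_join k c d) = (\<Sum>\<sigma>\<in>?C. \<Sum>\<tau>\<in>?D. simplex_boundary k (sjoin k \<sigma> \<tau>))"
    by (simp add: chain_boundary_eq_linear_extension chain_join_def linear_extension_sum)
  also have "\<dots> = (\<Sum>\<sigma>\<in>?C. \<Sum>\<tau>\<in>?D. ?l \<sigma> \<tau> + ?r \<sigma> \<tau>)"
    by (intro sum.cong refl simplex_boundary_join assms)
  also have "\<dots> = (\<Sum>\<sigma>\<in>?C. \<Sum>\<tau>\<in>?D. ?l \<sigma> \<tau>) + (\<Sum>\<sigma>\<in>?C. \<Sum>\<tau>\<in>?D. ?r \<sigma> \<tau>)"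
    by (simp add: sum.distrib)
  also have "(\<Sum>\<sigma>\<in>?C. \<Sum>\<tau>\<in>?D. ?l \<sigma> \<tau>) = chain_join k (chain_boundary k c) d"
  proof -
    have "(\<Sum>\<tau>\<in>?D. ?l \<sigma> \<tau>) =
        linear_extension
          (\<lambda>\<rho>. linear_extension (\<lambda>\<tau>. Poly_Mapping.single (sjoin k \<rho> \<tau>) (1 :: bit)) d)
          (simplex_boundary k \<sigma>)"
      for \<sigma>
      unfolding linear_extension_def by (rule sum.swap)
    then show ?thesis
      by (simp add: chain_join_eq_linear_extension chain_boundary_def linear_extension_sum)
  qed
  also have "(\<Sum>\<sigma>\<in>?C. \<Sum>\<tau>\<in>?D. ?r \<sigma> \<tau>) = chain_join k c (chain_boundary k d)"
    by (simp add: chain_join_eq_linear_extension chain_boundary_def linear_extension_sum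
        linear_extension_def[of _ c])
  finally show ?thesis .
qed

text \<open>
  Above the dimension of the empty simplex, the simplex \<open>{}\<close> that augments every complex, the
  void one included, cannot occur in a chain.
\<close>

lemma keys_subset_complex:
  assumes "c \<in> chains k X p" and "sdim k {} < p"
  shows "Poly_Mapping.keys c \<subseteq> {\<sigma> \<in> X. sdim k \<sigma> = p}"
  using assms unfolding chains_def by force

lemma chain_join_in_chains:
  assumes join: "\<And>\<sigma> \<tau>. \<sigma> \<in> K \<Longrightarrow> \<tau> \<in> L \<Longrightarrow> joinable k \<sigma> \<tau>"
    and "c \<in> chains k K p" "d \<in> chains k L q" and "sdim k {} < p" "sdim k {} < q"
  shows "chain_join k c d \<in> chains k (join_complex k K L) (p + q + 1)"
proof -
  have "Poly_Mapping.single (sjoin k \<sigma> \<tau>) 1 \<in> chains k (join_complex k K L) (p + q + 1)"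
    if "\<sigma> \<in> Poly_Mapping.keys c" "\<tau> \<in> Poly_Mapping.keys d" for \<sigma> \<tau>
  proof -
    have st: "\<sigma> \<in> K" "\<tau> \<in> L" "sdim k \<sigma> = p" "sdim k \<tau> = q"
      using that keys_subset_complex assms by blast+
    with join show ?thesis
      by (simp add: chains_def sdim_join join_in_join_complex)
  qed
  then show ?thesis unfolding chain_join_def by (intro chains_sum)
qed

text \<open>
  If one factor is the boundary of a chain, then the join of that chain with the other factor
  has the join of the two cycles as its boundary, because the remaining summand of the Leibniz
  rule contains the boundary of a cycle.
\<close>

lemma nontrivial_join_imp_nontrivial_factors:
  assumes join: "\<And>\<sigma> \<tau>. \<sigma> \<in> K \<Longrightarrow> \<tau> \<in> L \<Longrightarrow> joinable k \<sigma> \<tau>"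
    and dims: "sdim k {} < p" "sdim k {} < q"
    and w: "w \<in> cycles k K p" and z: "z \<in> cycles k L q"
    and nontrivial: "represents_nontrivial_class k (join_complex k K L) (p + q + 1) (chain_join k w z)"
  shows "represents_nontrivial_class k K p w \<and> represents_nontrivial_class k L q z"
proof -
  have leibniz: "chain_boundary k (chain_join k c d) =
      chain_join k (chain_boundary k c) d + chain_join k c (chain_boundary k d)"
    if "c \<in> chains k K m" "d \<in> chains k L n" "sdim k {} < m" "sdim k {} < n" for c d m n
    using that keys_subset_complex join by (intro chain_boundary_join) blast
  have not_bd: "chain_join k w z \<notin> boundaries k (join_complex k K L) (p + q + 1)"
    using nontrivial by (simp add: represents_nontrivial_class_iff)
  have wc: "w \<in> chains k K p" "chain_boundary k w = 0"
    and zc: "z \<in> chains k L q" "chain_boundary k z = 0"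
    using w z by (auto simp: cycles_def)
  have "w \<notin> boundaries k K p"
  proof
    assume "w \<in> boundaries k K p"
    then obtain c where c: "c \<in> chains k K (p + 1)" "w = chain_boundary k c"
      unfolding boundaries_def by blast
    have "chain_boundary k (chain_join k c z) = chain_join k w z"
      using leibniz[OF c(1) zc(1)] dims by (simp add: c(2) zc(2) chain_join_def)
    moreover have "chain_join k c z \<in> chains k (join_complex k K L) (p + 1 + q + 1)"
      using chain_join_in_chains[OF join c(1) zc(1)] dims by simp
    ultimately show False
      using not_bd unfolding boundaries_def by (force simp: algebra_simps)
  qed
  moreover have "z \<notin> boundaries k L q"
  proof
    assume "z \<in> boundaries k L q"
    then obtain d where d: "d \<in> chains k L (q + 1)" "z = chain_boundary k d"
      unfolding boundaries_def by blast
    have "chain_boundary k (chain_join k w d) = chain_join k w z"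
      using leibniz[OF wc(1) d(1)] dims by (simp add: d(2) wc(2) chain_join_def)
    moreover have "chain_join k w d \<in> chains k (join_complex k K L) (p + (q + 1) + 1)"
      using chain_join_in_chains[OF join wc(1) d(1)] dims by simp
    ultimately show False
      using not_bd unfolding boundaries_def by (force simp: algebra_simps)
  qed
  ultimately show ?thesis using w z by (simp add: represents_nontrivial_class_iff)
qed

section \<open>Joinable simplices in abstract and geometric complexes\<close>

lemma abstract_joinable:
  assumes K: "abstract_complex K" and L: "abstract_complex L"
    and disj: "vertices K \<inter> vertices L = {}" and "\<sigma> \<in> K" "\<tau> \<in> L"
  shows "joinable abstract_kind \<sigma> \<tau>"
proof -
  have "\<sigma> \<subseteq> vertices K" "\<tau> \<subseteq> vertices L"
    using assms unfolding abstract_complex_def vertices_def by blast+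
  moreover have "vertex_labelling abstract_kind (\<lambda>A. A) (\<sigma> \<union> \<tau>)"
    using assms by (auto simp: vertex_labelling_def abstract_kind_def abstract_complex_def)
  ultimately show ?thesis
    unfolding joinable_def using disj by (intro exI[of _ "\<lambda>A. A"]) blast
qed

text \<open>
  Every subset of an affinely independent set is recovered from its convex hull as the set of
  extreme points, and the faces of a simplex are the hulls of the sets of its vertices.
\<close>

lemma convex_hull_vertex_labelling:
  fixes V :: "'a::euclidean_space set"
  assumes V: "\<not> affine_dependent V"
  shows "vertex_labelling geometric_kind (\<lambda>A. convex hull A) V"
proof -
  have ind: "\<not> affine_dependent A" if "A \<subseteq> V" for A
    using V that affine_dependent_subset by blast
  have "inj_on (\<lambda>A. convex hull A) (Pow V)"
  proof (rule inj_onI)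
    fix A B assume AB: "A \<in> Pow V" "B \<in> Pow V" "convex hull A = convex hull B"
    have "{x. x extreme_point_of convex hull C} = C" if "C \<in> Pow V" for C
      using extreme_point_of_convex_hull_affine_independent[of C] ind[of C] that by auto
    then show "A = B" using AB by metis
  qed
  moreover have "aff_dim (convex hull A) = int (card A) - 1" if "A \<subseteq> V" for A
    using aff_dim_affine_independent[OF ind[OF that]] by (simp add: aff_dim_convex_hull)
  moreover have "\<rho> face_of convex hull A \<longleftrightarrow> (\<exists>B\<subseteq>A. \<rho> = convex hull B)" if "A \<subseteq> V" for A \<rho>
    using face_of_convex_hull_affine_independent[OF ind[OF that]] by blast
  moreover have "convex hull (convex hull A \<union> convex hull B) = convex hull (A \<union> B)"
    for A B :: "'a set"
    using hull_Un[of convex A B] by (simp add: convex_Inter)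
  moreover have "finite V" using V aff_independent_finite by blast
  ultimately show ?thesis by (simp add: vertex_labelling_def geometric_kind_def)
qed

text \<open>
  The vertices of a geometric simplex are its extreme points. They are 0-dimensional faces, hence
  vertices of the complex, which makes the vertex sets of the two simplices disjoint.
\<close>

lemma geometric_joinable:
  assumes K: "geometric_complex K" and L: "geometric_complex L"
    and disj: "vertices K \<inter> vertices L = {}" and ex: "geometric_join_exists K L"
    and S: "S \<in> K" and T: "T \<in> L"
  shows "joinable geometric_kind S T"
proof -
  have vertices_of: "\<exists>A. X = convex hull A \<and> {v. v extreme_point_of X} = A \<and> A \<subseteq> vertices M"
    if M: "geometric_complex M" "X \<in> M" for X and M :: "'a set set"
  proof -
    obtain n where "n simplex X" using M unfolding geometric_complex_def by blast
    then obtain A where A: "\<not> affine_dependent A" "X = convex hull A"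
      unfolding simplex by blast
    have ext: "{v. v extreme_point_of X} = A"
      using A by (simp add: extreme_point_of_convex_hull_affine_independent)
    have "{v} \<in> M" if "v \<in> A" for v
    proof -
      have "{v} face_of X" using ext that by (auto simp: face_of_singleton)
      then show ?thesis using M unfolding geometric_complex_def by blast
    qed
    then show ?thesis using A ext unfolding vertices_def by blast
  qed
  obtain A where A: "S = convex hull A" "{v. v extreme_point_of S} = A" "A \<subseteq> vertices K"
    using vertices_of[OF K S] by blast
  obtain B where B: "T = convex hull B" "{v. v extreme_point_of T} = B" "B \<subseteq> vertices L"
    using vertices_of[OF L T] by blast
  have "\<not> affine_dependent (A \<union> B)"
    using ex S T A(2) B(2) unfolding geometric_join_exists_def by blast
  then have "vertex_labelling geometric_kind (\<lambda>A. convex hull A) (A \<union> B)"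
    by (rule convex_hull_vertex_labelling)
  moreover have "A \<inter> B = {}" using A(3) B(3) disj by blast
  ultimately show ?thesis
    unfolding joinable_def using A(1) B(1) by (intro exI[of _ "\<lambda>A. convex hull A"]) blast
qed

theorem proposition1p3:
  fixes p q :: int
  assumes "0 \<le> p" and "0 \<le> q"
  shows
    "(\<forall>(K :: 'v set set) (L :: 'v set set) w z.
        abstract_complex K \<and> abstract_complex L \<and> vertices K \<inter> vertices L = {} \<and>
        w \<in> cycles abstract_kind K p \<and> z \<in> cycles abstract_kind L q \<and>
        represents_nontrivial_class abstract_kind (join_complex abstract_kind K L) (p + q + 1)
          (chain_join abstract_kind w z)
        \<longrightarrow> represents_nontrivial_class abstract_kind K p w \<and>
            represents_nontrivial_class abstract_kind L q z)
     \<and>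
     (\<forall>(K :: 'a::euclidean_space set set) (L :: 'a set set) w z.
        geometric_complex K \<and> geometric_complex L \<and> vertices K \<inter> vertices L = {} \<and>
        geometric_join_exists K L \<and>
        w \<in> cycles geometric_kind K p \<and> z \<in> cycles geometric_kind L q \<and>
        represents_nontrivial_class geometric_kind (join_complex geometric_kind K L) (p + q + 1)
          (chain_join geometric_kind w z)
        \<longrightarrow> represents_nontrivial_class geometric_kind K p w \<and>
            represents_nontrivial_class geometric_kind L q z)"
proof -
  have "sdim abstract_kind ({} :: 'v set) < p" "sdim abstract_kind ({} :: 'v set) < q"
    and "sdim geometric_kind ({} :: 'a set) < p" "sdim geometric_kind ({} :: 'a set) < q"
    using assms by (simp_all add: abstract_kind_def geometric_kind_def)
  note dims = this
  show ?thesis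
  proof (rule conjI; intro allI impI; elim conjE)
    show "represents_nontrivial_class abstract_kind K p w \<and> represents_nontrivial_class abstract_kind L q z"
      if "abstract_complex K" "abstract_complex L" "vertices K \<inter> vertices L = {}"
        "w \<in> cycles abstract_kind K p" "z \<in> cycles abstract_kind L q"
        "represents_nontrivial_class abstract_kind (join_complex abstract_kind K L) (p + q + 1)
          (chain_join abstract_kind w z)"
      for K L :: "'v set set" and w z
      using abstract_joinable[OF that(1-3)] dims(1,2) that(4-6)
      by (rule nontrivial_join_imp_nontrivial_factors)
    show "represents_nontrivial_class geometric_kind K p w \<and> represents_nontrivial_class geometric_kind L q z"
      if "geometric_complex K" "geometric_complex L" "vertices K \<inter> vertices L = {}"
        "geometric_join_exists K L"
        "w \<in> cycles geometric_kind K p" "z \<in> cycles geometric_kind L q"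
        "represents_nontrivial_class geometric_kind (join_complex geometric_kind K L) (p + q + 1)
          (chain_join geometric_kind w z)"
      for K L :: "'a set set" and w z
      using geometric_joinable[OF that(1-4)] dims(3,4) that(5-7)
      by (rule nontrivial_join_imp_nontrivial_factors)
  qed
qed

end
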